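(* Let $(L,\alpha)$ be a perfect Hom-Lie algebra with $\alpha$ surjective, and let $(V,\rho,\beta)$ be an $(L,\alpha)$-module with $\beta$ invertible such that $Z_V(L)=\{0\}$. Then for every skew-symmetric biderivation $\delta\in \mathrm{Bider}_{\mathrm s}(L,V)$ there exists $\gamma\in\mathrm{Cent}(L,V)$ such that $\delta(x,y)=\beta^{-1}\gamma([x,y])$ for all $x,y\in L$.
   Context: All vector spaces are over a fixed field $\mathbb F$ with $\mathrm{char}(\mathbb F)\neq 2$. A (multiplicative) Hom-Lie algebra $(L,\alpha)$ is a vector space $L$ with a bilinear bracket $[-,-]:L\times L\to L$ and a linear map $\alpha:L\to L$ such that $[x,y]=-[y,x]$, $[\alpha(x),[y,z]]+[\alpha(y),[z,x]]+[\alpha(z),[x,y]]=0$ and $\alpha([x,y])=[\alpha(x),\alpha(y)]$ for all $x,y,z\in L$. Put $L'=[L,L]$ (the span of all brackets); $(L,\alpha)$ is perfect if $L'=L$. An $(L,\alpha)$-module $(V,\rho,\beta)$ is a vector space $V$ with a linear map $\rho:L\to\mathrm{End}(V)$ and $\beta\in\mathrm{End}(V)$ such that for all $x,y\in L$: $\beta\rho(x)=\rho(\alpha(x))\beta$ and $\rho([x,y])\beta=\rho(\alpha(x))\rho(y)-\rho(\alpha(y))\rho(x)$. Write $xv=\rho(x)(v)$. Put $Z_V(L)=\{v\in V: xv=0\ \text{for all } x\in L\}$. $\mathrm{Bider}_{\mathrm s}(L,V)$ is the set of skew-symmetric biderivations, i.e. bilinear maps $\delta:L\times L\to V$ such that for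 all $x,y,z\in L$: $\delta(x,y)=-\delta(y,x)$, $\beta\delta(x,y)=\delta(\alpha(x),\alpha(y))$, $\delta(\alpha(z),[x,y])=\alpha(x)\delta(z,y)-\alpha(y)\delta(z,x)$, and $\delta([x,y],\alpha(z))=\alpha(x)\delta(y,z)-\alpha(y)\delta(x,z)$ (the last two are equivalent given skew-symmetry). The centroid $\mathrm{Cent}(L,V)$ is the set of linear maps $\gamma:L\to V$ such that $\gamma([x,y])=\alpha(x)\gamma(y)$ for all $x,y\in L$ and $\beta\circ\gamma=\gamma\circ\alpha$. *)

theory Defs
  imports "HOL-Computational_Algebra.Computational_Algebra"
begin

text \<open>
  Vector spaces over a field \<open>'k\<close> are whole types carrying a scalar multiplication that
  satisfies the library locale \<^locale>\<open>vector_space\<close>; no dimension is assumed to be finite.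
\<close>

definition bilinear_map ::
  "('k::field \<Rightarrow> 'a::ab_group_add \<Rightarrow> 'a) \<Rightarrow> ('k \<Rightarrow> 'b::ab_group_add \<Rightarrow> 'b) \<Rightarrow>
   ('k \<Rightarrow> 'c::ab_group_add \<Rightarrow> 'c) \<Rightarrow> ('a \<Rightarrow> 'b \<Rightarrow> 'c) \<Rightarrow> bool" where
  "bilinear_map sA sB sC f \<longleftrightarrow>
     (\<forall>x. Vector_Spaces.linear sB sC (\<lambda>y. f x y)) \<and>
     (\<forall>y. Vector_Spaces.linear sA sC (\<lambda>x. f x y))"

locale hom_lie_algebra = L: vector_space scaleL
  for scaleL :: "'k::field \<Rightarrow> 'l::ab_group_add \<Rightarrow> 'l" +
  fixes bracket :: "'l \<Rightarrow> 'l \<Rightarrow> 'l"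
    and \<alpha> :: "'l \<Rightarrow> 'l"
  assumes bracket_bilinear: "bilinear_map scaleL scaleL scaleL bracket"
    and alpha_linear: "Vector_Spaces.linear scaleL scaleL \<alpha>"
    and bracket_skew: "bracket x y = - bracket y x"
    and hom_jacobi: "bracket (\<alpha> x) (bracket y z) + bracket (\<alpha> y) (bracket z x)
                       + bracket (\<alpha> z) (bracket x y) = 0"
    and alpha_bracket: "\<alpha> (bracket x y) = bracket (\<alpha> x) (\<alpha> y)"

definition derived_algebra ::
  "('k::field \<Rightarrow> 'l::ab_group_add \<Rightarrow> 'l) \<Rightarrow> ('l \<Rightarrow> 'l \<Rightarrow> 'l) \<Rightarrow> 'l set" where
  "derived_algebra scaleL bracket = module.span scaleL {bracket x y | x y. True}"

definition perfect ::
  "('k::field \<Rightarrow> 'l::ab_group_add \<Rightarrow> 'l) \<Rightarrow> ('l \<Rightarrow> 'l \<Rightarrow> 'l) \<Rightarrow> bool" where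
  "perfect scaleL bracket \<longleftrightarrow> derived_algebra scaleL bracket = UNIV"

text \<open>
  The assumptions \<open>rho_endo\<close>, \<open>rho_add\<close> and \<open>rho_scale\<close> say that \<open>\<rho>\<close> is a linear map
  into \<open>End(V)\<close> with its pointwise vector space structure.
\<close>

locale hom_lie_module =
  hom_lie_algebra scaleL bracket \<alpha> + V: vector_space scaleV
  for scaleL :: "'k::field \<Rightarrow> 'l::ab_group_add \<Rightarrow> 'l"
    and bracket :: "'l \<Rightarrow> 'l \<Rightarrow> 'l"
    and \<alpha> :: "'l \<Rightarrow> 'l"
    and scaleV :: "'k \<Rightarrow> 'v::ab_group_add \<Rightarrow> 'v" +
  fixes \<rho> :: "'l \<Rightarrow> 'v \<Rightarrow> 'v"
    and \<beta> :: "'v \<Rightarrow> 'v"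
  assumes rho_endo: "Vector_Spaces.linear scaleV scaleV (\<rho> x)"
    and rho_add: "\<rho> (x + y) = (\<lambda>v. \<rho> x v + \<rho> y v)"
    and rho_scale: "\<rho> (scaleL c x) = (\<lambda>v. scaleV c (\<rho> x v))"
    and beta_linear: "Vector_Spaces.linear scaleV scaleV \<beta>"
    and beta_rho: "\<beta> \<circ> \<rho> x = \<rho> (\<alpha> x) \<circ> \<beta>"
    and rho_bracket: "\<rho> (bracket x y) \<circ> \<beta> = (\<lambda>v. \<rho> (\<alpha> x) (\<rho> y v) - \<rho> (\<alpha> y) (\<rho> x v))"

definition annihilated_vectors :: "('l \<Rightarrow> 'v \<Rightarrow> 'v::zero) \<Rightarrow> 'v set"  \<comment> \<open>\<open>Z\<^sub>V(L)\<close>\<close>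
  where "annihilated_vectors \<rho> = {v. \<forall>x. \<rho> x v = 0}"

definition Bider_s ::
  "('k::field \<Rightarrow> 'l::ab_group_add \<Rightarrow> 'l) \<Rightarrow> ('l \<Rightarrow> 'l \<Rightarrow> 'l) \<Rightarrow> ('l \<Rightarrow> 'l) \<Rightarrow>
   ('k \<Rightarrow> 'v::ab_group_add \<Rightarrow> 'v) \<Rightarrow> ('l \<Rightarrow> 'v \<Rightarrow> 'v) \<Rightarrow> ('v \<Rightarrow> 'v) \<Rightarrow>
   ('l \<Rightarrow> 'l \<Rightarrow> 'v) set" where
  "Bider_s scaleL bracket \<alpha> scaleV \<rho> \<beta> =
     {\<delta>. bilinear_map scaleL scaleL scaleV \<delta> \<and>
         (\<forall>x y. \<delta> x y = - \<delta> y x) \<and>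
         (\<forall>x y. \<beta> (\<delta> x y) = \<delta> (\<alpha> x) (\<alpha> y)) \<and>
         (\<forall>x y z. \<delta> (\<alpha> z) (bracket x y) = \<rho> (\<alpha> x) (\<delta> z y) - \<rho> (\<alpha> y) (\<delta> z x)) \<and>
         (\<forall>x y z. \<delta> (bracket x y) (\<alpha> z) = \<rho> (\<alpha> x) (\<delta> y z) - \<rho> (\<alpha> y) (\<delta> x z))}"

definition Cent ::
  "('k::field \<Rightarrow> 'l::ab_group_add \<Rightarrow> 'l) \<Rightarrow> ('l \<Rightarrow> 'l \<Rightarrow> 'l) \<Rightarrow> ('l \<Rightarrow> 'l) \<Rightarrow>
   ('k \<Rightarrow> 'v::ab_group_add \<Rightarrow> 'v) \<Rightarrow> ('l \<Rightarrow> 'v \<Rightarrow> 'v) \<Rightarrow> ('v \<Rightarrow> 'v) \<Rightarrow>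
   ('l \<Rightarrow> 'v) set" where
  "Cent scaleL bracket \<alpha> scaleV \<rho> \<beta> =
     {\<gamma>. Vector_Spaces.linear scaleL scaleV \<gamma> \<and>
         (\<forall>x y. \<gamma> (bracket x y) = \<rho> (\<alpha> x) (\<gamma> y)) \<and>
         \<beta> \<circ> \<gamma> = \<gamma> \<circ> \<alpha>}"

end

theory Submission
  imports Defs
begin

text \<open>
  Write \<open>a v\<close> for \<open>\<rho> a v\<close>. The wanted \<open>\<gamma>\<close> must satisfy \<open>\<gamma> [x,y] = \<beta> (\<delta> x y)\<close>. As \<open>L\<close> is
  spanned by brackets, this determines \<open>\<gamma>\<close>; the difficulty is that it is well defined.

  Expanding \<open>\<delta> [\<alpha> x, \<alpha> y] [\<alpha> u, \<alpha> v]\<close> by the derivation rule in one argument first, or in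
  the other one first, gives two expressions whose comparison is a symmetry of the four-variable
  map \<open>[x,u] (\<delta> y v) + [y,v] (\<delta> x u)\<close>: it is unchanged when \<open>u\<close> and \<open>v\<close> are exchanged, but it
  changes sign when \<open>x\<close> and \<open>u\<close> are. All transpositions are conjugate in the symmetric group,
  so both signs agree and, since the characteristic is not 2, the map vanishes:
  \<open>[x,u] (\<delta> y v) = - [y,v] (\<delta> x u)\<close> (lemma \<open>bracket_delta_exchange\<close>).

  Consequently a linear combination of the \<open>\<delta> x y\<close> whose corresponding combination of brackets
  is zero is annihilated by all brackets, hence by \<open>L\<close>, hence is zero. So there is a linear map
  \<open>g\<close> with \<open>g [x,y] = \<delta> x y\<close> (lemma \<open>factors_through_bracket\<close>), and \<open>\<gamma> = \<beta> \<circ> g\<close> is the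
  only candidate. It commutes with the twisting maps because \<open>\<delta>\<close> does. The module condition on
  \<open>\<gamma>\<close> becomes \<open>\<delta> x y = x (g y)\<close> after cancelling \<open>\<beta>\<close>. As \<open>\<alpha>\<close> is surjective and brackets span
  \<open>L\<close>, it suffices that \<open>\<delta> (\<alpha> z) [a,b] = (\<alpha> z) (\<delta> a b)\<close> (lemma \<open>delta_alpha_bracket\<close>), which
  follows from the derivation rule and the Hom-Jacobi identity transported along \<open>g\<close>.
\<close>

lemma (in vector_space) double_eq_zero:
  fixes x :: 'b
  assumes "CHAR('a) \<noteq> 2" and "x + x = 0"
  shows "x = 0"
proof -
  have "\<not> CHAR('a) dvd 2"
    using assms(1) CHAR_not_1 by (metis One_nat_def prime_nat_iff two_is_prime_nat)
  then have "of_nat 2 \<noteq> (0::'a)"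
    by (simp only: of_nat_eq_0_iff_char_dvd not_False_eq_True)
  moreover have "scale (of_nat 2) x = 0"
    using assms(2) by (metis of_nat_numeral one_add_one scale_left_distrib scale_one)
  ultimately show ?thesis
    by simp
qed

locale skew_biderivation =
  hom_lie_module scaleL bracket \<alpha> scaleV \<rho> \<beta>
  for scaleL :: "'k::field \<Rightarrow> 'l::ab_group_add \<Rightarrow> 'l"
    and bracket :: "'l \<Rightarrow> 'l \<Rightarrow> 'l"
    and \<alpha> :: "'l \<Rightarrow> 'l"
    and scaleV :: "'k \<Rightarrow> 'v::ab_group_add \<Rightarrow> 'v"
    and \<rho> :: "'l \<Rightarrow> 'v \<Rightarrow> 'v"
    and \<beta> :: "'v \<Rightarrow> 'v" +
  fixes \<delta> :: "'l \<Rightarrow> 'l \<Rightarrow> 'v"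
  assumes char_not_2: "CHAR('k) \<noteq> 2"
    and biderivation: "\<delta> \<in> Bider_s scaleL bracket \<alpha> scaleV \<rho> \<beta>"
    and beta_bij: "bij \<beta>"
begin

sublocale act: Vector_Spaces.linear scaleV scaleV "\<rho> x" for x
  by (rule rho_endo)

sublocale beta: Vector_Spaces.linear scaleV scaleV \<beta>
  by (rule beta_linear)

sublocale delta_right: Vector_Spaces.linear scaleL scaleV "\<delta> x" for x
  using biderivation by (simp add: Bider_s_def bilinear_map_def)

lemma delta_skew: "\<delta> x y = - \<delta> y x"
  using biderivation unfolding Bider_s_def by blast

lemma beta_delta: "\<beta> (\<delta> x y) = \<delta> (\<alpha> x) (\<alpha> y)"
  using biderivation unfolding Bider_s_def by blast

lemma delta_derivation_right:
  "\<delta> (\<alpha> z) (bracket x y) = \<rho> (\<alpha> x) (\<delta> z y) - \<rho> (\<alpha> y) (\<delta> z x)"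
  using biderivation unfolding Bider_s_def by blast

lemma delta_derivation_left:
  "\<delta> (bracket x y) (\<alpha> z) = \<rho> (\<alpha> x) (\<delta> y z) - \<rho> (\<alpha> y) (\<delta> x z)"
  using biderivation unfolding Bider_s_def by blast

lemma rho_minus: "\<rho> (- x) v = - \<rho> x v"
  using rho_scale[of "-1" x] by simp

lemma beta_rho_apply: "\<beta> (\<rho> x v) = \<rho> (\<alpha> x) (\<beta> v)"
  using fun_cong[OF beta_rho, of x v] by simp

lemma rho_commutator:
  "\<rho> (\<alpha> (\<alpha> x)) (\<rho> (\<alpha> y) v) - \<rho> (\<alpha> (\<alpha> y)) (\<rho> (\<alpha> x) v) = \<beta> (\<rho> (bracket x y) v)"
  using fun_cong[OF rho_bracket, of "\<alpha> x" "\<alpha> y" v]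
  by (simp add: beta_rho_apply alpha_bracket)

text \<open>
  The two sides of the comparison only involve commutators \<open>\<rho> (\<alpha>\<^sup>2 p) \<circ> \<rho> (\<alpha> q) - \<rho> (\<alpha>\<^sup>2 q) \<circ> \<rho> (\<alpha> p)\<close>,
  and each of them is the action of \<open>[p,q]\<close> followed by \<open>\<beta>\<close>; cancelling \<open>\<beta>\<close> leaves four terms.
\<close>

lemma bracket_delta_four_term:
  "\<rho> (bracket x u) (\<delta> y v) + \<rho> (bracket y v) (\<delta> x u)
   = \<rho> (bracket x v) (\<delta> y u) + \<rho> (bracket y u) (\<delta> x v)"
proof -
  let ?A = "\<lambda>x. \<rho> (\<alpha> (\<alpha> x))" and ?B = "\<lambda>x. \<rho> (\<alpha> x)"
  have "\<delta> (\<alpha> (bracket x y)) (bracket (\<alpha> u) (\<alpha> v))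
      = ?A u (?B x (\<delta> y v) - ?B y (\<delta> x v)) - ?A v (?B x (\<delta> y u) - ?B y (\<delta> x u))"
    by (simp only: delta_derivation_right delta_derivation_left)
  moreover have "\<delta> (bracket (\<alpha> x) (\<alpha> y)) (\<alpha> (bracket u v))
      = ?A x (?B u (\<delta> y v) - ?B v (\<delta> y u)) - ?A y (?B u (\<delta> x v) - ?B v (\<delta> x u))"
    by (simp only: delta_derivation_right delta_derivation_left)
  ultimately have
    "?A u (?B x (\<delta> y v) - ?B y (\<delta> x v)) - ?A v (?B x (\<delta> y u) - ?B y (\<delta> x u))
     = ?A x (?B u (\<delta> y v) - ?B v (\<delta> y u)) - ?A y (?B u (\<delta> x v) - ?B v (\<delta> x u))"
    by (simp only: alpha_bracket)
  then have
    "(?A x (?B u (\<delta> y v)) - ?A u (?B x (\<delta> y v))) + (?A y (?B v (\<delta> x u)) - ?A v (?B y (\<delta> x u)))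
     = (?A x (?B v (\<delta> y u)) - ?A v (?B x (\<delta> y u))) + (?A y (?B u (\<delta> x v)) - ?A u (?B y (\<delta> x v)))"
    by (simp add: act.diff algebra_simps)
  then have "\<beta> (\<rho> (bracket x u) (\<delta> y v) + \<rho> (bracket y v) (\<delta> x u))
      = \<beta> (\<rho> (bracket x v) (\<delta> y u) + \<rho> (bracket y u) (\<delta> x v))"
    by (simp add: rho_commutator beta.add)
  then show ?thesis
    using beta_bij by (simp add: bij_def inj_eq)
qed

lemma bracket_delta_exchange:
  "\<rho> (bracket x u) (\<delta> y v) = - \<rho> (bracket y v) (\<delta> x u)"
proof -
  define S where "S x u y v = \<rho> (bracket x u) (\<delta> y v) + \<rho> (bracket y v) (\<delta> x u)" for x u y v
  have swap24: "S x u y v = S x v y u" for x u y v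
    unfolding S_def by (rule bracket_delta_four_term)
  have swap12: "S x u y v = - S u x y v" for x u y v
    unfolding S_def using bracket_skew[of x u] delta_skew[of x u]
    by (simp add: rho_minus act.neg)
  \<comment> \<open>The transposition of the first two arguments is conjugate to that of the second and fourth.\<close>
  have "S x u y v = - S x u y v"
    by (metis swap12 swap24)
  then have "S x u y v + S x u y v = 0"
    by (metis add.right_inverse)
  then have "S x u y v = 0"
    using V.double_eq_zero[OF char_not_2] by blast
  then show ?thesis
    by (simp add: S_def eq_neg_iff_add_eq_0)
qed

text \<open>
  The value \<open>g z\<close> is pinned down by the conditions \<open>[u,v] (g z) = - z (\<delta> u v)\<close>, which make no
  reference to a decomposition of \<open>z\<close> into brackets. They have at most one solution because the
  brackets span \<open>L\<close> and \<open>L\<close> annihilates only zero. They are solvable for \<open>z = [x,y]\<close>, with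
  solution \<open>\<delta> x y\<close>, by the exchange identity, hence for all \<open>z\<close> by linearity.
\<close>

lemma factors_through_bracket:
  assumes perf: "perfect scaleL bracket" and faithful: "annihilated_vectors \<rho> = {0}"
  obtains g where "Vector_Spaces.linear scaleL scaleV g" "\<And>x y. g (bracket x y) = \<delta> x y"
proof -
  have span_brackets: "z \<in> L.span {bracket x y | x y. True}" for z
    using perf by (simp add: perfect_def derived_algebra_def)
  define sol where "sol z w \<longleftrightarrow> (\<forall>u v. \<rho> (bracket u v) w = - \<rho> z (\<delta> u v))" for z w
  have rho_0: "\<rho> 0 v = 0" for v
    using rho_scale[of 0 0] by simp
  have unique: "w = w'" if "sol z w" "sol z w'" for z w w'
  proof -
    have "\<rho> a (w - w') = 0" for a
      using span_brackets[of a]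
    proof (induction rule: L.span_induct)
      case base
      show ?case
        by (auto simp: L.subspace_def rho_0 rho_add rho_scale)
    next
      case (step a)
      then show ?case
        using that by (auto simp: sol_def act.diff)
    qed
    then have "w - w' \<in> annihilated_vectors \<rho>"
      by (simp add: annihilated_vectors_def)
    then show ?thesis
      using faithful by simp
  qed
  have sol_bracket: "sol (bracket x y) (\<delta> x y)" for x y
    unfolding sol_def using bracket_delta_exchange by blast
  have sol_0: "sol 0 0"
    by (simp add: sol_def rho_0 act.zero)
  have sol_add: "sol (y + z) (v + w)" if "sol y v" "sol z w" for y z v w
    using that by (simp add: sol_def act.add rho_add)
  have sol_scale: "sol (scaleL c z) (scaleV c w)" if "sol z w" for c z w
    using that by (simp add: sol_def act.scale rho_scale)
  have "\<exists>w. sol z w" for z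
    using span_brackets[of z]
  proof (induction rule: L.span_induct)
    case base
    show ?case
      unfolding L.subspace_def using sol_0 sol_add sol_scale by blast
  next
    case (step z)
    then show ?case
      using sol_bracket by blast
  qed
  then obtain g where g: "\<And>z. sol z (g z)"
    by metis
  show thesis
  proof
    show "Vector_Spaces.linear scaleL scaleV g"
      using unique g sol_add sol_scale by unfold_locales blast+
    show "g (bracket x y) = \<delta> x y" for x y
      using unique g sol_bracket by blast
  qed
qed

text \<open>
  With \<open>T = (\<alpha> z) (\<delta> a b) + (\<alpha> a) (\<delta> b z) + (\<alpha> b) (\<delta> z a)\<close>, the derivation rule reads
  \<open>\<delta> (\<alpha> z) [a,b] = (\<alpha> z) (\<delta> a b) - T\<close>. Summing cyclically, the left side becomes zero as \<open>g\<close>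
  carries the Hom-Jacobi identity to it, while the right side becomes \<open>T - 3 T\<close>; so \<open>T = 0\<close>.
\<close>

lemma delta_alpha_bracket:
  assumes lin: "Vector_Spaces.linear scaleL scaleV g" and g: "\<And>x y. g (bracket x y) = \<delta> x y"
  shows "\<delta> (\<alpha> z) (bracket a b) = \<rho> (\<alpha> z) (\<delta> a b)"
proof -
  interpret g: Vector_Spaces.linear scaleL scaleV g
    by (rule lin)
  define T where "T = \<rho> (\<alpha> z) (\<delta> a b) + \<rho> (\<alpha> a) (\<delta> b z) + \<rho> (\<alpha> b) (\<delta> z a)"
  have skew: "\<rho> c (\<delta> x y) = - \<rho> c (\<delta> y x)" for c x y
    using delta_skew[of x y] by (simp add: act.neg)
  have 1: "\<delta> (\<alpha> z) (bracket a b) = \<rho> (\<alpha> z) (\<delta> a b) - T"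
    using skew[of "\<alpha> a" z b] by (simp add: T_def delta_derivation_right)
  have 2: "\<delta> (\<alpha> a) (bracket b z) = \<rho> (\<alpha> a) (\<delta> b z) - T"
    using skew[of "\<alpha> b" a z] by (simp add: T_def delta_derivation_right)
  have 3: "\<delta> (\<alpha> b) (bracket z a) = \<rho> (\<alpha> b) (\<delta> z a) - T"
    using skew[of "\<alpha> z" b a] by (simp add: T_def delta_derivation_right)
  have "\<delta> (\<alpha> z) (bracket a b) + \<delta> (\<alpha> a) (bracket b z) + \<delta> (\<alpha> b) (bracket z a) = 0"
    using arg_cong[OF hom_jacobi[of z a b], of g] by (simp add: g.add g.zero g)
  moreover have "T + T = - (\<delta> (\<alpha> z) (bracket a b) + \<delta> (\<alpha> a) (bracket b z) + \<delta> (\<alpha> b) (bracket z a))"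
    unfolding 1 2 3 by (simp add: T_def algebra_simps)
  ultimately have "T + T = 0"
    by simp
  then have "T = 0"
    using V.double_eq_zero[OF char_not_2] by blast
  with 1 show ?thesis
    by simp
qed

lemma delta_arises_from_centroid:
  assumes perf: "perfect scaleL bracket" and surj: "surj \<alpha>"
    and faithful: "annihilated_vectors \<rho> = {0}"
  shows "\<exists>\<gamma> \<in> Cent scaleL bracket \<alpha> scaleV \<rho> \<beta>. \<forall>x y. \<delta> x y = inv \<beta> (\<gamma> (bracket x y))"
proof -
  obtain g where lin: "Vector_Spaces.linear scaleL scaleV g"
    and g: "\<And>x y. g (bracket x y) = \<delta> x y"
    using factors_through_bracket[OF perf faithful] by metis
  interpret g: Vector_Spaces.linear scaleL scaleV g
    by (rule lin)
  interpret alpha: Vector_Spaces.linear scaleL scaleL \<alpha>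
    by (rule alpha_linear)
  have span_brackets: "z \<in> L.span {bracket x y | x y. True}" for z
    using perf by (simp add: perfect_def derived_algebra_def)
  have beta_g: "\<beta> (g z) = g (\<alpha> z)" for z
    using span_brackets[of z]
  proof (induction rule: L.span_induct)
    case base
    show ?case
      by (auto simp: L.subspace_def g.add g.scale g.zero alpha.add alpha.scale alpha.zero
          beta.add beta.scale beta.zero)
  next
    case (step z)
    then show ?case
      by (auto simp: g alpha_bracket beta_delta)
  qed
  have "\<delta> (\<alpha> z) y = \<rho> (\<alpha> z) (g y)" for z y
    using span_brackets[of y]
  proof (induction rule: L.span_induct)
    case base
    show ?case
      by (auto simp: L.subspace_def g.add g.scale g.zero act.add act.scale act.zero
          delta_right.add delta_right.scale delta_right.zero)
  next
    case (step y)
    then show ?case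
      using delta_alpha_bracket[OF lin g] by (auto simp: g)
  qed
  then have delta_eq: "\<delta> x y = \<rho> x (g y)" for x y
    using surj by (metis surjD)
  have "\<beta> \<circ> g \<in> Cent scaleL bracket \<alpha> scaleV \<rho> \<beta>"
    unfolding Cent_def
  proof (intro CollectI conjI allI)
    show "Vector_Spaces.linear scaleL scaleV (\<beta> \<circ> g)"
      using Vector_Spaces.linear_compose[OF lin beta_linear] .
    show "(\<beta> \<circ> g) (bracket x y) = \<rho> (\<alpha> x) ((\<beta> \<circ> g) y)" for x y
      by (simp add: g delta_eq beta_rho_apply)
    show "\<beta> \<circ> (\<beta> \<circ> g) = (\<beta> \<circ> g) \<circ> \<alpha>"
      by (simp add: fun_eq_iff beta_g)
  qed
  moreover have "\<delta> x y = inv \<beta> ((\<beta> \<circ> g) (bracket x y))" for x y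
    using beta_bij by (simp add: g bij_def)
  ultimately show ?thesis
    by blast
qed

end

theorem theorem3p6:
  fixes scaleL :: "'k::field \<Rightarrow> 'l::ab_group_add \<Rightarrow> 'l"
    and bracket :: "'l \<Rightarrow> 'l \<Rightarrow> 'l"
    and \<alpha> :: "'l \<Rightarrow> 'l"
    and scaleV :: "'k \<Rightarrow> 'v::ab_group_add \<Rightarrow> 'v"
    and \<rho> :: "'l \<Rightarrow> 'v \<Rightarrow> 'v"
    and \<beta> :: "'v \<Rightarrow> 'v"
  assumes "CHAR('k) \<noteq> 2"
    and "hom_lie_algebra scaleL bracket \<alpha>"
    and "perfect scaleL bracket"
    and "surj \<alpha>"
    and "hom_lie_module scaleL bracket \<alpha> scaleV \<rho> \<beta>"
    and "bij \<beta>"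
    and "annihilated_vectors \<rho> = {0}"
  shows "\<forall>\<delta> \<in> Bider_s scaleL bracket \<alpha> scaleV \<rho> \<beta>.
           \<exists>\<gamma> \<in> Cent scaleL bracket \<alpha> scaleV \<rho> \<beta>.
             \<forall>x y. \<delta> x y = inv \<beta> (\<gamma> (bracket x y))"
proof
  fix \<delta> assume "\<delta> \<in> Bider_s scaleL bracket \<alpha> scaleV \<rho> \<beta>"
  then interpret skew_biderivation scaleL bracket \<alpha> scaleV \<rho> \<beta> \<delta>
    using assms by (simp add: skew_biderivation_def skew_biderivation_axioms_def)
  show "\<exists>\<gamma> \<in> Cent scaleL bracket \<alpha> scaleV \<rho> \<beta>. \<forall>x y. \<delta> x y = inv \<beta> (\<gamma> (bracket x y))"
    using assms by (intro delta_arises_from_centroid)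
qed

end
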